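(* Fix $\alpha>0$ and $\lambda\in(0,1]$, and for each integer $n\ge 1$ let $d_\alpha(n):=d_\alpha\big(Z_n(\lambda),Z(\lambda)\big)$. Then for every $n\ge1$, $$d_{\alpha}(n)=\frac{\alpha^n \lambda^{n+1}}{n!}\int_0^1 (1-y)^n e^{\alpha\lambda y}\,\mathrm{d}y.$$ Moreover, for every $n\ge 1$, $$\frac{\alpha^{n}\lambda^{n+1}}{(n+1)!}\left(1+\frac{\alpha\lambda}{n+2}+\frac{\alpha^2\lambda^2}{(n+2)(n+3)}\right)<d_\alpha(n)<\frac{\alpha^{n}\lambda^{n+1}}{(n+1)!}\left(1+\frac{\alpha\lambda}{n+2}+\frac{\alpha^2\lambda^2 e^{\alpha\lambda}}{(n+2)(n+3)}\right).$$ Hence, as $n\to\infty$, $$d_\alpha(n)\sim\frac{\alpha^n\lambda^{n+1}}{(n+1)!}\quad\text{and, more precisely,}\quad d_\alpha(n)=\frac{\alpha^{n}\lambda^{n+1}}{(n+1)!}\left(1+\frac{\alpha\lambda}{n+2}+o\left(\frac1n\right)\right).$$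
   Context: For $x\in\mathbb{R}$ let $(x)_0=1$ and $(x)_k=x(x-1)\cdots(x-k+1)$ for $k=1,2,\ldots$; $\mathbb{E}(X)_k$ denotes the expectation of $(X)_k$. For $\alpha>0$ and random variables $X_1,X_2$ with values in $\{0,1,2,\ldots\}$ such that $\mathbb{E}[(1+t')^{X_i}]<\infty$ for some $t'>0$ ($i=1,2$), the factorial moment distance of order $\alpha$ is $$d_\alpha(X_1,X_2):=\sum_{k=1}^{\infty}\frac{\alpha^{k-1}}{k!}\big|\mathbb{E}(X_1)_k-\mathbb{E}(X_2)_k\big|\in[0,\infty].$$ For $n\ge1$ and $\lambda\in(0,1]$, the random variable $Z_n(\lambda)$ (generalized matching distribution) is defined by $Z_n(\lambda)=\sum_{i=1}^n J_i\,\mathbf{1}\{\pi_n(i)=i\}$, where $\pi_n$ is a uniformly random permutation of $\{1,\ldots,n\}$ and $J_1,\ldots,J_n$ are i.i.d. Bernoulli($\lambda$) random variables independent of $\pi_n$; equivalently, its probability mass function is $$\mathbb{P}(Z_n(\lambda)=j)=\frac{\lambda^j}{j!}\sum_{i=0}^{n-j}\frac{(-\lambda)^i}{i!},\qquad j=0,1,\ldots,n.$$ $Z(\lambda)$ is a Poisson random variable with mean $\lambda$. $a_n\sim b_n$ means $\lim_{n\to\infty}a_n/b_n=1$. *)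

theory Defs
  imports "HOL-Probability.Probability" "HOL-Library.Landau_Symbols"
begin

text \<open>Random variables with values in \<open>{0, 1, 2, \<dots>}\<close> enter only through their laws,
  which are elements of \<^typ>\<open>nat pmf\<close>.\<close>

definition falling_factorial :: "real \<Rightarrow> nat \<Rightarrow> real" where
  "falling_factorial x k = (\<Prod>i<k. x - real i)"

definition factorial_moment :: "nat pmf \<Rightarrow> nat \<Rightarrow> real" where
  "factorial_moment p k = measure_pmf.expectation p (\<lambda>x. falling_factorial (real x) k)"

text \<open>The summation index is shifted by one. The value is meaningful for laws having a finite
  exponential moment \<open>\<E>((1 + t)\<^sup>X)\<close> for some \<open>t > 0\<close>, see \<open>integrable_falling_factorial\<close>;
  \<open>exponential_moment_matching\<close> and \<open>exponential_moment_poisson\<close> below show that the laws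
  of interest do.\<close>

definition factorial_moment_distance :: "real \<Rightarrow> nat pmf \<Rightarrow> nat pmf \<Rightarrow> ennreal" where
  "factorial_moment_distance \<alpha> p q =
     (\<Sum>k. ennreal (\<alpha> ^ k / fact (Suc k)
                 * \<bar>factorial_moment p (Suc k) - factorial_moment q (Suc k)\<bar>))"

text \<open>The law of \<open>\<Sum>i=1..n. J\<^sub>i 1{\<pi>(i) = i}\<close>, where \<open>\<pi>\<close> is a uniformly random
  permutation of \<open>{1..n}\<close> and \<open>J\<^sub>1, \<dots>, J\<^sub>n\<close> are i.i.d. Bernoulli variables with
  parameter \<open>lam\<close>, independent of \<open>\<pi>\<close>.\<close>

definition generalized_matching_pmf :: "nat \<Rightarrow> real \<Rightarrow> nat pmf" where
  "generalized_matching_pmf n lam =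
     map_pmf (\<lambda>(\<pi>, J). \<Sum>i=1..n. of_bool (J i) * of_bool (\<pi> i = i))
       (pair_pmf (pmf_of_set {\<pi>. \<pi> permutes {1..n}})
                 (Pi_pmf {1..n} False (\<lambda>_. bernoulli_pmf lam)))"

definition matching_distance :: "real \<Rightarrow> real \<Rightarrow> nat \<Rightarrow> ennreal" where
  "matching_distance \<alpha> lam n =
     factorial_moment_distance \<alpha> (generalized_matching_pmf n lam) (poisson_pmf lam)"

lemma falling_factorial_of_nat:
  "falling_factorial (real x) k = fact k * real (x choose k)"
proof -
  have "real (x choose k) = (\<Prod>i<k. real x - real i) / fact k"
    by (simp add: binomial_gbinomial gbinomial_prod_rev atLeast0LessThan)
  then show ?thesis
    by (simp add: falling_factorial_def)
qed

lemma integrable_falling_factorial: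
  fixes t :: real
  assumes "t > 0" "integrable (measure_pmf p) (\<lambda>x. (1 + t) ^ x)"
  shows "integrable (measure_pmf p) (\<lambda>x. falling_factorial (real x) k)"
proof (rule Bochner_Integration.integrable_bound)
  show "integrable (measure_pmf p) (\<lambda>x. fact k / t ^ k * (1 + t) ^ x)"
    using assms(2) by (rule integrable_mult_right)
  have "falling_factorial (real x) k \<le> fact k / t ^ k * (1 + t) ^ x" for x :: nat
  proof -
    have "real (x choose k) * t ^ k \<le> (t + 1) ^ x"
    proof (cases "k \<le> x")
      case True
      have "real (x choose k) * t ^ k \<le> (\<Sum>j\<le>x. real (x choose j) * t ^ j)"
        using True \<open>t > 0\<close>
        by (intro member_le_sum[of k "{..x}" "\<lambda>j. real (x choose j) * t ^ j"]) auto
      also have "\<dots> = (t + 1) ^ x"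
        by (simp add: binomial_ring)
      finally show ?thesis .
    qed (use \<open>t > 0\<close> in \<open>simp add: binomial_eq_0\<close>)
    then show ?thesis
      using \<open>t > 0\<close> by (simp add: falling_factorial_of_nat field_simps)
  qed
  then show "AE x in measure_pmf p. norm (falling_factorial (real x) k)
      \<le> norm (fact k / t ^ k * (1 + t) ^ x)"
    using \<open>t > 0\<close> by (simp add: falling_factorial_of_nat)
qed simp

lemma exponential_moment_matching:
  "integrable (measure_pmf (generalized_matching_pmf n lam)) (\<lambda>x. (1 + t :: real) ^ x)"
proof (rule integrable_measure_pmf_finite)
  have "(\<Sum>i=1..n. of_bool (J i) * of_bool (\<pi> i = i)) \<le> n"
    for \<pi> :: "nat \<Rightarrow> nat" and J :: "nat \<Rightarrow> bool"
  proof -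
    have "(\<Sum>i=1..n. of_bool (J i) * of_bool (\<pi> i = i)) \<le> (\<Sum>i=1..n. 1 :: nat)"
      by (intro sum_mono) auto
    then show ?thesis
      by simp
  qed
  then have "set_pmf (generalized_matching_pmf n lam) \<subseteq> {..n}"
    unfolding generalized_matching_pmf_def set_map_pmf by (auto simp del: sum_mult_of_bool_eq)
  then show "finite (set_pmf (generalized_matching_pmf n lam))"
    by (rule finite_subset) simp
qed

lemma exponential_moment_poisson:
  fixes lam t :: real
  assumes "lam > 0" "t > 0"
  shows "integrable (measure_pmf (poisson_pmf lam)) (\<lambda>x. (1 + t) ^ x)"
proof -
  have eq: "pmf (poisson_pmf lam) x *\<^sub>R (1 + t) ^ x
      = exp (- lam) * (((1 + t) * lam) ^ x /\<^sub>R fact x)" for x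
    using assms by (simp add: power_mult_distrib divide_simps mult_ac)
  have "summable (\<lambda>x. exp (- lam) * (((1 + t) * lam) ^ x /\<^sub>R fact x))"
    by (intro summable_mult summable_exp_generic)
  then have "integrable (count_space UNIV) (\<lambda>x. pmf (poisson_pmf lam) x *\<^sub>R (1 + t) ^ x)"
    unfolding eq integrable_count_space_nat_iff using assms by (simp add: abs_mult)
  then show ?thesis
    unfolding measure_pmf_eq_density by (subst integrable_density) auto
qed

end

theory Submission
  imports Defs "HOL-Real_Asymp.Real_Asymp"
begin

text \<open>Counting \<open>k\<close>-subsets of marked fixed points shows that the \<open>k\<close>-th factorial moment of the
  generalized matching distribution is \<open>lam ^ k\<close> for \<open>k \<le> n\<close>, as for the Poisson distribution,
  and \<open>0\<close> for \<open>k > n\<close>. Hence the distance is the tail of an exponential series with leading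
  term \<open>\<alpha> ^ n * lam ^ (n + 1) / fact (n + 1)\<close>. Integration by parts identifies this tail with the
  integral; keeping three of its terms gives the lower bound, and comparing everything after the
  first two with \<open>exp (\<alpha> * lam)\<close> gives the upper bound.\<close>

section \<open>Factorial moments of the two laws\<close>

lemma prob_pair_pmf_Times:
  "measure_pmf.prob (pair_pmf M N) (A \<times> B) = measure_pmf.prob M A * measure_pmf.prob N B"
proof -
  \<comment> \<open>The product rule applied below is for countable sets; cutting both factors down
    to their supports makes them countable without changing any probability.\<close>
  have "measure_pmf.prob (pair_pmf M N) (A \<times> B) =
      measure_pmf.prob (pair_pmf M N) ((A \<times> B) \<inter> set_pmf (pair_pmf M N))"
    by (simp only: measure_Int_set_pmf)
  also have "(A \<times> B) \<inter> set_pmf (pair_pmf M N) = (A \<inter> set_pmf M) \<times> (B \<inter> set_pmf N)"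
    by auto
  also have "measure_pmf.prob (pair_pmf M N) \<dots> =
      measure_pmf.prob M (A \<inter> set_pmf M) * measure_pmf.prob N (B \<inter> set_pmf N)"
    by (intro measure_pmf_prob_product countable_Int2 countable_set_pmf)
  finally show ?thesis
    by (simp add: measure_Int_set_pmf)
qed

text \<open>The permutations of \<open>A\<close> that fix \<open>T\<close> pointwise are exactly the
  permutations of \<open>A - T\<close>, so counting them is counting permutations of a smaller
  set.\<close>

lemma prob_permutation_fixes:
  assumes "finite A" "T \<subseteq> A"
  shows "measure_pmf.prob (pmf_of_set {\<pi>. \<pi> permutes A}) {\<pi>. \<forall>i\<in>T. \<pi> i = i} =
           fact (card A - card T) / fact (card A)"
proof -
  have "{\<pi>. \<pi> permutes A} \<inter> {\<pi>. \<forall>i\<in>T. \<pi> i = i} = {\<pi>. \<pi> permutes (A - T)}"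
    using assms(2)
    by (auto intro: permutes_superset permutes_subset dest: permutes_not_in)
  moreover have "{\<pi>. \<pi> permutes A} \<noteq> {}"
    using permutes_id by blast
  moreover have "finite T"
    using assms finite_subset by blast
  ultimately show ?thesis
    using assms
    by (simp add: measure_pmf_of_set finite_permutations card_permutations card_Diff_subset)
qed

lemma prob_Pi_pmf_bernoulli_all:
  assumes "finite A" "T \<subseteq> A" "0 \<le> p" "p \<le> 1"
  shows "measure_pmf.prob (Pi_pmf A d (\<lambda>_. bernoulli_pmf p)) {J. \<forall>i\<in>T. J i} = p ^ card T"
proof -
  \<comment> \<open>The event is written as a box, unconstrained in the coordinates outside
    \<open>T\<close>, so that independence turns its probability into a product over
    \<open>A\<close>.\<close>
  have "{J. \<forall>i\<in>T. J i} = Pi A (\<lambda>i. if i \<in> T then {True} else UNIV)"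
    using assms(2) by (fastforce simp: Pi_iff)
  moreover have "measure_pmf.prob (Pi_pmf A d (\<lambda>_. bernoulli_pmf p))
       (Pi A (\<lambda>i. if i \<in> T then {True} else UNIV)) = 
       (\<Prod>i\<in>A. measure_pmf.prob (bernoulli_pmf p) (if i \<in> T then {True} else UNIV))"
    using assms(1) by (rule measure_Pi_pmf_Pi)
  moreover have "\<dots> = (\<Prod>i\<in>A. if i \<in> T then p else 1)"
    using assms by (intro prod.cong) (auto simp: measure_pmf_single)
  moreover have "\<dots> = p ^ card T"
    using assms by (simp add: prod.If_cases Int_absorb1)
  ultimately show ?thesis
    by simp
qed

text \<open>Both sides count the \<open>k\<close>-subsets of \<open>A\<close> on which
  \<open>P\<close> holds throughout. The right-hand form is a sum of indicators, whose expectation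
  can be taken term by term.\<close>

lemma real_card_choose_eq_sum_indicator:
  assumes "finite A"
  shows "real (card {i \<in> A. P i} choose k) = (\<Sum>T | T \<subseteq> A \<and> card T = k. of_bool (\<forall>i\<in>T. P i))"
proof -
  have "card {i \<in> A. P i} choose k = card {T. T \<subseteq> {i \<in> A. P i} \<and> card T = k}"
    using assms by (simp add: n_subsets)
  also have "{T. T \<subseteq> {i \<in> A. P i} \<and> card T = k} = 
      {T. T \<subseteq> A \<and> card T = k} \<inter> {T. \<forall>i\<in>T. P i}"
    by auto
  finally show ?thesis
    using assms by simp
qed

text \<open>Each of the \<open>n choose k\<close> index sets consists of marked fixed points with
  probability \<open>fact (n - k) / fact n * lam ^ k\<close>. Multiplied by \<open>fact k\<close>,
  the factorials cancel; for \<open>k > n\<close> there is no such index set.\<close>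

lemma factorial_moment_generalized_matching:
  assumes "0 \<le> lam" "lam \<le> 1"
  shows "factorial_moment (generalized_matching_pmf n lam) k = (if k \<le> n then lam ^ k else 0)"
proof -
  define M where "M = pair_pmf (pmf_of_set {\<pi>. \<pi> permutes {1..n}})
                 (Pi_pmf {1..n} False (\<lambda>_. bernoulli_pmf lam))"
  define TT where "TT = {T. T \<subseteq> {1..n} \<and> card T = k}"
  \<comment> \<open>\<open>E T\<close> is a rectangle, so the independence of the permutation and
    the marks factors its probability.\<close>
  define E where "E = (\<lambda>T. {\<pi> :: nat \<Rightarrow> nat. \<forall>i\<in>T. \<pi> i = i} \<times> {J :: nat \<Rightarrow> bool. \<forall>i\<in>T. J i})"
  have count: "falling_factorial (real (\<Sum>i=1..n. of_bool (J i) * of_bool (\<pi> i = i))) k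
      = fact k * (\<Sum>T\<in>TT. indicator (E T) (\<pi>, J))" for \<pi> :: "nat \<Rightarrow> nat" and J :: "nat \<Rightarrow> bool"
  proof -
    have "(\<Sum>i=1..n. of_bool (J i) * of_bool (\<pi> i = i)) = card {i \<in> {1..n}. J i \<and> \<pi> i = i}"
      by (simp add: of_bool_conj [symmetric] Int_def del: sum_mult_of_bool_eq)
    then show ?thesis
      using real_card_choose_eq_sum_indicator[of "{1..n}" "\<lambda>i. J i \<and> \<pi> i = i" k]
      unfolding falling_factorial_of_nat TT_def
      by (auto simp del: sum_of_bool_eq sum_mult_of_bool_eq simp: E_def indicator_def intro!: sum.cong)
  qed
  have "factorial_moment (generalized_matching_pmf n lam) k
      = measure_pmf.expectation M (\<lambda>x. fact k * (\<Sum>T\<in>TT. indicator (E T) x))"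
    unfolding factorial_moment_def generalized_matching_pmf_def M_def[symmetric] integral_map_pmf
    by (intro Bochner_Integration.integral_cong refl) (simp only: split_beta count prod.collapse)
  also have "\<dots> = fact k * (\<Sum>T\<in>TT. measure_pmf.prob M (E T))"
    by (simp add: Bochner_Integration.integral_sum measure_pmf.emeasure_eq_measure)
  also have "(\<Sum>T\<in>TT. measure_pmf.prob M (E T)) =
      (\<Sum>T\<in>TT. fact (n - k) / fact n * lam ^ k)"
    by (intro sum.cong refl)
      (use assms in \<open>auto simp: M_def E_def TT_def prob_pair_pmf_Times prob_permutation_fixes
          prob_Pi_pmf_bernoulli_all\<close>)
  also have "\<dots> = real (n choose k) * (fact (n - k) / fact n * lam ^ k)"
    by (simp add: TT_def n_subsets)
  \<comment> \<open>For \<open>k > n\<close> the truncated difference \<open>n - k\<close> does no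
    harm, because \<open>n choose k\<close> vanishes.\<close>
  also have "fact k * \<dots> = (if k \<le> n then lam ^ k else 0)"
    by (simp add: binomial_fact binomial_eq_0)
  finally show ?thesis .
qed

text \<open>The falling factorial kills the first \<open>k\<close> terms and cancels against the
  factorial in the mass function in the others, which leaves the exponential series shifted by
  \<open>k\<close>.\<close>

lemma factorial_moment_poisson:
  assumes "lam > 0"
  shows "factorial_moment (poisson_pmf lam) k = lam ^ k"
proof -
  define f where "f = (\<lambda>x. pmf (poisson_pmf lam) x * falling_factorial (real x) k)"
  have f_shift: "f (x + k) = exp (- lam) * lam ^ k * (lam ^ x /\<^sub>R fact x)" for x
    using assms by (simp add: f_def falling_factorial_of_nat binomial_fact power_add field_simps)
  have "(\<lambda>x. f (x + k)) sums (exp (- lam) * lam ^ k * exp lam)"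
    unfolding f_shift by (intro sums_mult exp_converges)
  moreover have "f x = 0" if "x < k" for x
    using that by (simp add: f_def falling_factorial_of_nat)
  ultimately have sums: "f sums (exp (- lam) * lam ^ k * exp lam)"
    by (simp add: sums_iff_shift)
  \<comment> \<open>Nonnegativity makes the convergence absolute, as integrability over the counting
    measure demands.\<close>
  have nonneg: "f x \<ge> 0" for x
    by (simp add: f_def falling_factorial_of_nat)
  have "factorial_moment (poisson_pmf lam) k = integral\<^sup>L (count_space UNIV) f"
    unfolding factorial_moment_def measure_pmf_eq_density f_def
    by (subst integral_density) auto
  also have "\<dots> = suminf f"
    using sums nonneg
    by (intro integral_count_space_nat) (simp add: integrable_count_space_nat_iff sums_iff)
  also have "\<dots> = lam ^ k"
    using sums by (simp add: sums_iff exp_minus)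
  finally show ?thesis .
qed

section \<open>The normalised exponential tail, Kummer's function 1F1(1; n + 2; x), and its integral
  form\<close>

definition factorial_tail :: "real \<Rightarrow> nat \<Rightarrow> real" where
  "factorial_tail x n = (\<Sum>j. x ^ j * (fact (n + 1) / fact (n + 1 + j)))"

text \<open>Makes the exponential series a termwise majorant of the tail for x \<ge> 0, both for
  summability and for the upper bound.\<close>

lemma fact_ratio_le: "fact m / fact (m + j) \<le> (1 / fact j :: real)"
proof -
  have "fact m * fact j dvd (fact (m + j) :: nat)"
    by (rule fact_fact_dvd_fact)
  then have "fact m * fact j \<le> (fact (m + j) :: nat)"
    by (rule dvd_imp_le) simp
  then have "real (fact m * fact j) \<le> real (fact (m + j))"
    by (simp only: of_nat_le_iff)
  then show ?thesis
    by (simp add: field_simps)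
qed

lemma summable_factorial_tail:
  assumes "x \<ge> 0"
  shows "summable (\<lambda>j. x ^ j * (fact m / fact (m + j)) :: real)"
proof (rule summable_comparison_test')
  show "summable (\<lambda>j. x ^ j / fact j)"
    using summable_exp_generic[of x] by (simp add: divide_inverse_commute)
  show "norm (x ^ j * (fact m / fact (m + j))) \<le> x ^ j / fact j" for j
    using mult_left_mono[OF fact_ratio_le[of m j], of "x ^ j"] assms by simp
qed

text \<open>Induction on \<open>n\<close>: integration by parts expresses the integral for
  \<open>Suc n\<close> through the one for \<open>n\<close>, and the series obeys the same
  recursion. Both the base case and the recursion divide by \<open>x\<close>.\<close>

lemma integral_exp_power_sums:
  fixes x :: real
  assumes "x \<noteq> 0"
  shows "(\<lambda>j. x ^ j * (fact n / fact (n + 1 + j)))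
           sums integral {0..1} (\<lambda>y. (1 - y) ^ n * exp (x * y))"
proof (induction n)
  case 0
  have "((\<lambda>y. exp (x * y)) has_integral (exp (x * 1) / x - exp (x * 0) / x)) {0..1}"
    using assms
    by (intro fundamental_theorem_of_calculus)
      (auto intro!: derivative_eq_intros simp flip: has_real_derivative_iff_has_vector_derivative)
  then have int: "integral {0..1} (\<lambda>y. exp (x * y)) = (exp x - 1) / x"
    by (simp add: integral_unique diff_divide_distrib)
  have "(\<lambda>j. x ^ Suc j / fact (Suc j)) sums (exp x - 1)"
    using exp_converges[of x] by (subst sums_Suc_iff) (simp add: divide_inverse_commute)
  then have "(\<lambda>j. x ^ Suc j / fact (Suc j) / x) sums ((exp x - 1) / x)"
    by (rule sums_divide)
  then show ?case
    using assms by (simp add: int)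
next
  case (Suc n)
  let ?g = "\<lambda>n y. (1 - y) ^ n * exp (x * y)"
  let ?a = "\<lambda>n j. x ^ j * (fact n / fact (n + 1 + j))"
  have integrable: "?g m integrable_on {0..1}" for m
    by (intro integrable_continuous_real continuous_intros)
  have "(?g (Suc n) has_real_derivative x * ?g (Suc n) y - real (Suc n) * ?g n y)
      (at y within {0..1})" for y
    by (rule derivative_eq_intros refl)+ (simp add: algebra_simps)
  then have "((\<lambda>y. x * ?g (Suc n) y - real (Suc n) * ?g n y) has_integral
      (?g (Suc n) 1 - ?g (Suc n) 0)) {0..1}"
    by (intro fundamental_theorem_of_calculus)
      (simp_all only: zero_le_one flip: has_real_derivative_iff_has_vector_derivative)
  \<comment> \<open>The boundary term is \<open>0 - 1\<close>: the power of \<open>1 - y\<close>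
    vanishes at 1, and both factors equal 1 at 0.\<close>
  then have "integral {0..1} (\<lambda>y. x * ?g (Suc n) y - real (Suc n) * ?g n y) = -1"
    by (simp add: integral_unique)
  moreover have "integral {0..1} (\<lambda>y. x * ?g (Suc n) y - real (Suc n) * ?g n y) =
      x * integral {0..1} (?g (Suc n)) - real (Suc n) * integral {0..1} (?g n)"
    by (subst integral_diff) (simp_all only: integral_mult_right integrable integrable_on_mult_right)
  ultimately have rec: "integral {0..1} (?g (Suc n)) = (real (Suc n) * integral {0..1} (?g n) - 1) / x"
    using assms by (simp add: field_simps)
  \<comment> \<open>The recursion on the series side: after scaling by \<open>Suc n\<close> the term
    of index 0 is 1, so subtracting 1 drops it, and dividing by \<open>x\<close> turns the rest into
    the series for \<open>Suc n\<close>.\<close>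
  have "(\<lambda>j. real (Suc n) * ?a n j) sums (real (Suc n) * integral {0..1} (?g n))"
    using Suc by (rule sums_mult)
  moreover have "real (Suc n) * ?a n 0 = 1"
    by simp
  ultimately have "(\<lambda>j. real (Suc n) * ?a n (Suc j)) sums (real (Suc n) * integral {0..1} (?g n) - 1)"
    by (simp only: sums_Suc_iff [where f = "\<lambda>j. real (Suc n) * ?a n j"] diff_add_cancel)
  then have "(\<lambda>j. real (Suc n) * ?a n (Suc j) / x) sums integral {0..1} (?g (Suc n))"
    unfolding rec by (rule sums_divide)
  moreover have "real (Suc n) * ?a n (Suc j) / x = ?a (Suc n) j" for j
    using assms by simp
  ultimately show ?case
    by (simp only:)
qed

lemma integral_eq_factorial_tail:
  fixes x :: real
  assumes "x \<noteq> 0"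
  shows "integral {0..1} (\<lambda>y. (1 - y) ^ n * exp (x * y)) / fact n = factorial_tail x n / fact (n + 1)"
proof -
  \<comment> \<open>The factor \<open>n + 1\<close> raises the numerator \<open>fact n\<close> to
    \<open>fact (n + 1)\<close>, which normalises the leading term to 1.\<close>
  have "(\<lambda>j. real (n + 1) * (x ^ j * (fact n / fact (n + 1 + j))))
      sums (real (n + 1) * integral {0..1} (\<lambda>y. (1 - y) ^ n * exp (x * y)))"
    by (intro sums_mult integral_exp_power_sums assms)
  moreover have "real (n + 1) * (x ^ j * (fact n / fact (n + 1 + j))) = 
      x ^ j * (fact (n + 1) / fact (n + 1 + j))" for j
    by simp
  ultimately have "factorial_tail x n = real (n + 1) * integral {0..1} (\<lambda>y. (1 - y) ^ n * exp (x * y))"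
    by (simp only: factorial_tail_def sums_iff)
  then show ?thesis
    by simp
qed

section \<open>Two-sided bounds and asymptotics of the tail\<close>

lemma fact_ratio_1: "fact (n + 1) / fact (n + 1 + 1) = 1 / (real n + 2)"
  by (simp add: fact_Suc [of "Suc n"] del: fact_Suc)

lemma fact_ratio_2: "fact (n + 1) / fact (n + 1 + 2) = 1 / ((real n + 2) * (real n + 3))"
  by (simp add: fact_Suc [of "Suc n"] fact_Suc [of "Suc (Suc n)"] mult.commute add.commute
      del: fact_Suc)

lemma factorial_tail_gt:
  assumes "x > 0"
  shows "1 + x / (real n + 2) + x\<^sup>2 / ((real n + 2) * (real n + 3)) < factorial_tail x n"
proof -
  \<comment> \<open>All omitted terms are positive, so the truncation is strictly smaller.\<close>
  have "(\<Sum>j<3. x ^ j * (fact (n + 1) / fact (n + 1 + j))) < factorial_tail x n"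
    unfolding factorial_tail_def
    using assms by (intro sum_less_suminf summable_factorial_tail) auto
  moreover have "(\<Sum>j<3. x ^ j * (fact (n + 1) / fact (n + 1 + j))) =
      x ^ 0 * (fact (n + 1) / fact (n + 1 + 0)) + x ^ 1 * (fact (n + 1) / fact (n + 1 + 1))
        + x\<^sup>2 * (fact (n + 1) / fact (n + 1 + 2))"
    by (simp add: numeral_3_eq_3 numeral_2_eq_2 del: fact_Suc)
  moreover have "\<dots> = 1 + x / (real n + 2) + x\<^sup>2 / ((real n + 2) * (real n + 3))"
    unfolding fact_ratio_1 fact_ratio_2 by simp
  ultimately show ?thesis
    by simp
qed

text \<open>From index 2 on, the common factor \<open>?c\<close> splits off and leaves a series of
  the same shape with \<open>n + 3\<close> in place of \<open>n + 1\<close>, which lies strictly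
  below the exponential series.\<close>

lemma factorial_tail_lt:
  assumes "x > 0"
  shows "factorial_tail x n <
           1 + x / (real n + 2) + x\<^sup>2 * exp x / ((real n + 2) * (real n + 3))"
proof -
  let ?m = "n + 3"
  let ?c = "x\<^sup>2 / ((real n + 2) * (real n + 3))"
  let ?d = "\<lambda>j. x ^ j /\<^sub>R fact j - x ^ j * (fact ?m / fact (?m + j))"
  have c: "?c > 0"
    using assms by (simp add: add_pos_pos)
  have sum: "summable (\<lambda>j. x ^ j * (fact ?m / fact (?m + j)))"
    using assms by (intro summable_factorial_tail) auto
  have "?d j \<ge> 0" for j
    using mult_left_mono[OF fact_ratio_le[of ?m j], of "x ^ j"] assms
    by (simp add: divide_inverse mult.commute)
  \<comment> \<open>The two series agree at index 0, so strictness is taken from index 1.\<close>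
  moreover have "?d 1 > 0"
  proof -
    have "fact ?m / fact (?m + 1) = 1 / (real n + 4)"
      using fact_ratio_1[of "n + 2"] by (simp add: numeral_3_eq_3 del: fact_Suc)
    then have "?d 1 = x * (1 - 1 / (real n + 4))"
      by (simp only:) (simp add: algebra_simps)
    then show ?thesis
      using assms by simp
  qed
  ultimately have "0 < (\<Sum>j. ?d j)"
    by (intro suminf_pos2 summable_diff sum summable_exp_generic)
  also have "\<dots> = exp x - (\<Sum>j. x ^ j * (fact ?m / fact (?m + j)))"
    unfolding exp_def by (rule suminf_diff [symmetric, OF summable_exp_generic sum])
  finally have less: "(\<Sum>j. x ^ j * (fact ?m / fact (?m + j))) < exp x"
    by simp
  have shift: "x ^ (j + 2) * (fact (n + 1) / fact (n + 1 + (j + 2))) = 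
      ?c * (x ^ j * (fact ?m / fact (?m + j)))" for j
  proof -
    have "n + 1 + (j + 2) = ?m + j" "n + 1 + 2 = ?m"
      by simp_all
    then have "fact (n + 1) / fact (n + 1 + (j + 2)) =
        fact (n + 1) / fact (n + 1 + 2) * (fact ?m / fact (?m + j) :: real)"
      by (simp only:) (simp del: fact_Suc)
    then show ?thesis
      unfolding fact_ratio_2 by (simp add: power_add power2_eq_square del: fact_Suc)
  qed
  have "factorial_tail x n = (\<Sum>j. x ^ (j + 2) * (fact (n + 1) / fact (n + 1 + (j + 2))))
      + (\<Sum>j<2. x ^ j * (fact (n + 1) / fact (n + 1 + j)))"
    unfolding factorial_tail_def
    using assms by (intro suminf_split_initial_segment summable_factorial_tail) auto
  also have "(\<Sum>j<2. x ^ j * (fact (n + 1) / fact (n + 1 + j))) = 1 + x / (real n + 2)"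
    by (simp add: numeral_2_eq_2)
  also have "(\<Sum>j. x ^ (j + 2) * (fact (n + 1) / fact (n + 1 + (j + 2)))) =
      ?c * (\<Sum>j. x ^ j * (fact ?m / fact (?m + j)))"
    unfolding shift by (rule suminf_mult[OF sum])
  also have "\<dots> < ?c * exp x"
    using less c by (rule mult_strict_left_mono)
  finally show ?thesis
    by simp
qed

text \<open>Centred form of the two bounds; the positive sign removes the absolute value in the
  Landau estimate.\<close>

lemma factorial_tail_bounds:
  assumes "x > 0"
  shows "0 < factorial_tail x n - (1 + x / (real n + 2))"
    and "factorial_tail x n - (1 + x / (real n + 2)) < x\<^sup>2 * exp x / ((real n + 2) * (real n + 3))"
proof -
  have "0 \<le> x\<^sup>2 / ((real n + 2) * (real n + 3))"
    by simp
  then show "0 < factorial_tail x n - (1 + x / (real n + 2))"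
    using factorial_tail_gt[OF assms, of n] by linarith
qed (use factorial_tail_lt[OF assms, of n] in linarith)

text \<open>The remainder lies between 0 and a constant multiple of
  \<open>1 / ((n + 2) * (n + 3))\<close>, hence is of order at most \<open>1 / n^2\<close>.\<close>

lemma factorial_tail_remainder_smallo:
  assumes "x > 0"
  shows "(\<lambda>n. factorial_tail x n - (1 + x / (real n + 2))) \<in> o(\<lambda>n. 1 / real n)"
proof (rule landau_o.big_small_trans)
  show "(\<lambda>n. factorial_tail x n - (1 + x / (real n + 2)))
      \<in> O(\<lambda>n. x\<^sup>2 * exp x / ((real n + 2) * (real n + 3)))"
    using factorial_tail_bounds[OF assms]
    by (intro landau_o.big_mono always_eventually allI) (simp add: less_imp_le)
  show "(\<lambda>n. x\<^sup>2 * exp x / ((real n + 2) * (real n + 3))) \<in> o(\<lambda>n. 1 / real n)"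
    using assms by real_asymp
qed

lemma factorial_tail_tendsto_1:
  assumes "x > 0"
  shows "(\<lambda>n. factorial_tail x n) \<longlonglongrightarrow> 1"
proof (rule tendsto_sandwich)
  show "\<forall>\<^sub>F n in sequentially. 1 + x / (real n + 2) \<le> factorial_tail x n"
    using factorial_tail_bounds(1)[OF assms] by (simp add: less_imp_le)
  show "\<forall>\<^sub>F n in sequentially. factorial_tail x n
      \<le> 1 + x / (real n + 2) + x\<^sup>2 * exp x / ((real n + 2) * (real n + 3))"
    using factorial_tail_lt[OF assms] by (simp add: less_imp_le)
qed real_asymp+

section \<open>The distance as a scaled tail, and the final assembly\<close>

lemma matching_distance_eq:
  assumes "\<alpha> > 0" "0 < lam" "lam \<le> 1"
  shows "matching_distance \<alpha> lam n =
           ennreal (\<alpha> ^ n * lam ^ (n + 1) / fact (n + 1) * factorial_tail (\<alpha> * lam) n)"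
proof -
  let ?x = "\<alpha> * lam"
  let ?A = "\<alpha> ^ n * lam ^ (n + 1) / fact (n + 1)"
  let ?t = "\<lambda>j. ?x ^ j * (fact (n + 1) / fact (n + 1 + j))"
  define f where "f = (\<lambda>k. \<alpha> ^ k / fact (Suc k)
     * \<bar>factorial_moment (generalized_matching_pmf n lam) (Suc k)
        - factorial_moment (poisson_pmf lam) (Suc k)\<bar>)"
  \<comment> \<open>Index \<open>k\<close> carries the moment of order \<open>Suc k\<close>, so the
    moments agree exactly when \<open>Suc k \<le> n\<close>, that is \<open>k < n\<close>.\<close>
  have f_eq: "f k = (if k < n then 0 else \<alpha> ^ k * lam ^ Suc k / fact (Suc k))" for k
    using assms
    by (auto simp: f_def factorial_moment_generalized_matching factorial_moment_poisson
        simp del: fact_Suc power_Suc)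
  have "?t sums factorial_tail ?x n"
    unfolding factorial_tail_def
    using assms by (intro summable_sums summable_factorial_tail) auto
  then have "(\<lambda>j. ?A * ?t j) sums (?A * factorial_tail ?x n)"
    by (rule sums_mult)
  moreover have "?A * ?t j = f (j + n)" for j
    by (simp add: f_eq power_add power_mult_distrib ac_simps del: fact_Suc)
  ultimately have "(\<lambda>j. f (j + n)) sums (?A * factorial_tail ?x n)"
    by simp
  then have "f sums (?A * factorial_tail ?x n)"
    unfolding sums_iff_shift by (simp add: f_eq)
  \<comment> \<open>With nonnegative summable terms, the sum in \<open>ennreal\<close> is the
    embedded real sum.\<close>
  moreover have "f k \<ge> 0" for k
    using assms by (simp add: f_eq)
  moreover have "matching_distance \<alpha> lam n = (\<Sum>k. ennreal (f k))"
    unfolding matching_distance_def factorial_moment_distance_def f_def by (rule refl)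
  ultimately show ?thesis
    by (simp only: suminf_ennreal2 sums_iff)
qed

theorem theorem3p1:
  fixes \<alpha> lam :: real
  assumes "\<alpha> > 0" and "0 < lam" and "lam \<le> 1"
  shows "(\<forall>n\<ge>1. matching_distance \<alpha> lam n =
            ennreal (\<alpha> ^ n * lam ^ (n + 1) / fact n
                     * integral {0..1} (\<lambda>y. (1 - y) ^ n * exp (\<alpha> * lam * y)))) \<and>
         (\<forall>n\<ge>1.
            ennreal (\<alpha> ^ n * lam ^ (n + 1) / fact (n + 1)
                     * (1 + \<alpha> * lam / (real n + 2)
                          + \<alpha>\<^sup>2 * lam\<^sup>2 / ((real n + 2) * (real n + 3))))
              < matching_distance \<alpha> lam n \<and>
            matching_distance \<alpha> lam n
              < ennreal (\<alpha> ^ n * lam ^ (n + 1) / fact (n + 1)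
                     * (1 + \<alpha> * lam / (real n + 2)
                          + \<alpha>\<^sup>2 * lam\<^sup>2 * exp (\<alpha> * lam) / ((real n + 2) * (real n + 3))))) \<and>
         (\<lambda>n. enn2real (matching_distance \<alpha> lam n))
            \<sim>[at_top] (\<lambda>n. \<alpha> ^ n * lam ^ (n + 1) / fact (n + 1)) \<and>
         (\<exists>r :: nat \<Rightarrow> real. r \<in> o(\<lambda>n. 1 / real n) \<and>
            (\<forall>n\<ge>1. enn2real (matching_distance \<alpha> lam n) =
               \<alpha> ^ n * lam ^ (n + 1) / fact (n + 1) * (1 + \<alpha> * lam / (real n + 2) + r n)))"
proof -
  define x where "x = \<alpha> * lam"
  define A where "A = (\<lambda>n. \<alpha> ^ n * lam ^ (n + 1) / fact (n + 1))"
  have x: "x > 0" and A: "A n > 0" for n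
    using assms by (simp_all add: x_def A_def)
  have dist: "matching_distance \<alpha> lam n = ennreal (A n * factorial_tail x n)" for n
    using matching_distance_eq[OF assms] by (simp only: x_def A_def)
  \<comment> \<open>\<open>ennreal\<close> sends negative reals to 0, so a strict comparison needs a
    positive right-hand side; likewise \<open>enn2real\<close> gives back only nonnegative
    values.\<close>
  have pos: "0 < 1 + x / (real n + 2) + x\<^sup>2 / ((real n + 2) * (real n + 3))" for n
    using x by (simp add: add_pos_nonneg)
  then have tail_pos: "0 < factorial_tail x n" for n
    using factorial_tail_gt[OF x] less_trans by blast
  then have dist_real: "enn2real (matching_distance \<alpha> lam n) = A n * factorial_tail x n" for n
    using A by (simp add: dist less_imp_le)
  have "matching_distance \<alpha> lam n = ennreal (\<alpha> ^ n * lam ^ (n + 1) / fact n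
      * integral {0..1} (\<lambda>y. (1 - y) ^ n * exp (x * y)))" for n
  proof -
    have tail: "factorial_tail x n / fact (n + 1) =
        integral {0..1} (\<lambda>y. (1 - y) ^ n * exp (x * y)) / fact n"
      by (rule integral_eq_factorial_tail [symmetric]) (use x in simp)
    have "A n * factorial_tail x n = \<alpha> ^ n * lam ^ (n + 1) * (factorial_tail x n / fact (n + 1))"
      by (simp add: A_def)
    also have "\<dots> = \<alpha> ^ n * lam ^ (n + 1) / fact n
        * integral {0..1} (\<lambda>y. (1 - y) ^ n * exp (x * y))"
      unfolding tail by simp
    finally show ?thesis
      by (simp only: dist)
  qed
  moreover have "ennreal (A n * (1 + x / (real n + 2) + x\<^sup>2 / ((real n + 2) * (real n + 3))))
      < matching_distance \<alpha> lam n" for n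
    unfolding dist
    using A pos factorial_tail_gt[OF x]
    by (intro ennreal_lessI mult_pos_pos mult_strict_left_mono tail_pos)
  moreover have "matching_distance \<alpha> lam n
      < ennreal (A n * (1 + x / (real n + 2) + x\<^sup>2 * exp x / ((real n + 2) * (real n + 3))))" for n
    unfolding dist
    using A tail_pos less_trans[OF tail_pos factorial_tail_lt[OF x]] factorial_tail_lt[OF x]
    by (intro ennreal_lessI mult_pos_pos mult_strict_left_mono)
  moreover have "(\<lambda>n. enn2real (matching_distance \<alpha> lam n)) \<sim>[at_top] A"
  proof (rule asymp_equivI')
    have "enn2real (matching_distance \<alpha> lam n) / A n = factorial_tail x n" for n
      using A[of n] by (simp add: dist_real)
    then show "((\<lambda>n. enn2real (matching_distance \<alpha> lam n) / A n) \<longlongrightarrow> 1) at_top"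
      using factorial_tail_tendsto_1[OF x] by simp
  qed
  \<comment> \<open>The witness is the remainder of the tail after its first two terms.\<close>
  moreover have "\<exists>r :: nat \<Rightarrow> real. r \<in> o(\<lambda>n. 1 / real n) \<and>
      (\<forall>n\<ge>1. enn2real (matching_distance \<alpha> lam n) = A n * (1 + x / (real n + 2) + r n))"
    using factorial_tail_remainder_smallo[OF x]
    by (intro exI[of _ "\<lambda>n. factorial_tail x n - (1 + x / (real n + 2))"])
      (simp add: dist_real)
  ultimately show ?thesis
    by (simp only: x_def A_def power_mult_distrib) blast
qed

end
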